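(* Let a rigid homogeneous ball of mass $m$ and radius $R$ move in continuous contact with the table $z=0$ and the cushion $y=0$ (so $y=R$, $z=R$), with isotropic friction coefficients $\mu_t,\mu_c>0$ at the table and at the cushion. Put $$S_t=\sqrt{R^2\omega_x^2+(\dot x-R\omega_y)^2},\qquad S_c=\sqrt{R^2\omega_x^2+(\dot x+R\omega_z)^2},$$ and suppose $S_t,S_c\ne0$. Then the Lagrange multipliers $\lambda_c,\lambda_t$ of the contacts with the cushion and the table are uniquely determined by the equations of motion and equal $$\lambda_c=\frac{mg\,\mu_tR\,\omega_x\,S_c}{\mu_c\mu_tR^2\omega_x^2+S_tS_c},\qquad \lambda_t=\frac{mg\,S_tS_c}{\mu_c\mu_tR^2\omega_x^2+S_tS_c}.$$ In particular, in contrast with the case of a single point of contact, the Lagrange multipliers can depend on the friction coefficients.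
   Context: $x,y,z$ are the coordinates of the ball's center, $(\omega_x,\omega_y,\omega_z)$ is its angular velocity vector, and $g>0$ is the acceleration of gravity. The ball lies in the region $z\ge R$, $y\ge R$. The friction force at each contact is minus the friction coefficient times the corresponding multiplier ($\lambda_t$ or $\lambda_c$) times the unit vector of the velocity of the ball's point at that contact. The equations of motion under the constraints $y=R$, $z=R$ are $$m\ddot x=-\frac{\lambda_t\mu_t(\dot x-R\omega_y)}{S_t}-\frac{\lambda_c\mu_c(\dot x+R\omega_z)}{S_c},$$ $$0=\lambda_c-\frac{\lambda_t\mu_tR\omega_x}{S_t},\qquad 0=-mg+\lambda_t+\frac{\lambda_c\mu_cR\omega_x}{S_c},$$ $$\tfrac25mR\,\dot\omega_x=-R\omega_x\Bigl(\frac{\lambda_t\mu_t}{S_t}+\frac{\lambda_c\mu_c}{S_c}\Bigr),$$ $$\tfrac25mR\,\dot\omega_y=\frac{\lambda_t\mu_t(\dot x-R\omega_y)}{S_t},\qquad \tfrac25mR\,\dot\omega_z=-\frac{\lambda_c\mu_c(\dot x+R\omega_z)}{S_c}.$$ *)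

theory Defs
  imports "HOL-Analysis.Analysis"
begin

text \<open>
  The table is the plane \<open>z = 0\<close> and the cushion the plane \<open>y = 0\<close>; the ball is on the side
  \<open>z > 0\<close>, \<open>y > 0\<close>.
\<close>

datatype surface = Table | Cushion

fun normal :: "surface \<Rightarrow> real ^ 3" where
  "normal Table = axis 3 1"
| "normal Cushion = axis 2 1"

text \<open>
  Throughout, \<open>v\<close> and \<open>a\<close> are the velocity and the acceleration of the ball's center, \<open>w\<close> and \<open>b\<close>
  the angular velocity and the angular acceleration, \<open>mu s\<close> is the friction coefficient of the
  surface \<open>s\<close>, and \<open>l s\<close> is the Lagrange multiplier of the contact with \<open>s\<close>, that is, the
  coefficient of the reaction along the normal.
\<close>

definition contact_arm :: "real \<Rightarrow> surface \<Rightarrow> real ^ 3" where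
  "contact_arm R s = - R *\<^sub>R normal s"

definition contact_velocity :: "real \<Rightarrow> real ^ 3 \<Rightarrow> real ^ 3 \<Rightarrow> surface \<Rightarrow> real ^ 3" where
  "contact_velocity R v w s = v + cross3 w (contact_arm R s)"

text \<open>
  \<open>sgn u\<close> is the unit vector of \<open>u\<close>.  The law is meaningful only for a sliding contact; with the
  library convention \<open>sgn 0 = 0\<close> the term is junk otherwise, so sliding is always assumed explicitly
  where the force is used.
\<close>

definition friction_force ::
  "real \<Rightarrow> (surface \<Rightarrow> real) \<Rightarrow> real ^ 3 \<Rightarrow> real ^ 3 \<Rightarrow> (surface \<Rightarrow> real) \<Rightarrow> surface \<Rightarrow> real ^ 3" where
  "friction_force R mu v w l s = - (mu s * l s) *\<^sub>R sgn (contact_velocity R v w s)"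

definition contact_force ::
  "real \<Rightarrow> (surface \<Rightarrow> real) \<Rightarrow> real ^ 3 \<Rightarrow> real ^ 3 \<Rightarrow> (surface \<Rightarrow> real) \<Rightarrow> surface \<Rightarrow> real ^ 3" where
  "contact_force R mu v w l s = l s *\<^sub>R normal s + friction_force R mu v w l s"

text \<open>
  Equations of motion of the ball touching exactly the surfaces in \<open>K\<close>; a homogeneous ball has the
  moment of inertia \<open>2/5 m R\<^sup>2\<close> about every axis through its center.  For
  \<open>K = {Table, Cushion}\<close> they are written out in coordinates in \<open>eqs_of_motion_coordinates\<close> below.
\<close>

definition eqs_of_motion ::
  "real \<Rightarrow> real \<Rightarrow> real \<Rightarrow> (surface \<Rightarrow> real) \<Rightarrow> surface set \<Rightarrow>
   real ^ 3 \<Rightarrow> real ^ 3 \<Rightarrow> real ^ 3 \<Rightarrow> real ^ 3 \<Rightarrow> (surface \<Rightarrow> real) \<Rightarrow> bool" where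
  "eqs_of_motion m R g mu K v w a b l \<longleftrightarrow>
     m *\<^sub>R a = - (m * g) *\<^sub>R axis 3 1 + (\<Sum>s\<in>K. contact_force R mu v w l s) \<and>
     (2/5 * m * R\<^sup>2) *\<^sub>R b = (\<Sum>s\<in>K. cross3 (contact_arm R s) (contact_force R mu v w l s))"

text \<open>
  The multipliers admitted by the equations of motion in the state \<open>(v, w)\<close>, when the contacts
  persist: the center has no acceleration along the normals of the surfaces touched.
\<close>

definition contact_multipliers ::
  "real \<Rightarrow> real \<Rightarrow> real \<Rightarrow> (surface \<Rightarrow> real) \<Rightarrow> surface set \<Rightarrow>
   real ^ 3 \<Rightarrow> real ^ 3 \<Rightarrow> (surface \<Rightarrow> real) \<Rightarrow> bool" where
  "contact_multipliers m R g mu K v w l \<longleftrightarrow>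
     (\<exists>a b. (\<forall>s\<in>K. a \<bullet> normal s = 0) \<and> eqs_of_motion m R g mu K v w a b l)"

text \<open>
  Motion during the time interval \<open>T\<close> in continuous contact with exactly the surfaces in \<open>K\<close>;
  \<open>q\<close> is the ball's center and \<open>l t\<close> gives the multipliers at time \<open>t\<close>.
\<close>

definition ball_motion ::
  "real \<Rightarrow> real \<Rightarrow> real \<Rightarrow> (surface \<Rightarrow> real) \<Rightarrow> surface set \<Rightarrow> real set \<Rightarrow>
   (real \<Rightarrow> real ^ 3) \<Rightarrow> (real \<Rightarrow> real ^ 3) \<Rightarrow> (real \<Rightarrow> real ^ 3) \<Rightarrow> (real \<Rightarrow> surface \<Rightarrow> real) \<Rightarrow> bool"
where
  "ball_motion m R g mu K T q v w l \<longleftrightarrow>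
     is_interval T \<and> interior T \<noteq> {} \<and>
     (\<forall>t\<in>T. \<forall>s. if s \<in> K then q t \<bullet> normal s = R else q t \<bullet> normal s > R) \<and>
     (\<exists>a b. \<forall>t\<in>T.
        (q has_vector_derivative v t) (at t within T) \<and>
        (v has_vector_derivative a t) (at t within T) \<and>
        (w has_vector_derivative b t) (at t within T) \<and>
        eqs_of_motion m R g mu K (v t) (w t) (a t) (b t) (l t))"

text \<open>
  The multiplier of the contact with \<open>s\<close> depends on the friction coefficients: two sliding motions
  that differ in the friction coefficients, but have the same state at some instant, have different
  multipliers at that instant.
\<close>

definition multiplier_depends_on_friction ::
  "real \<Rightarrow> real \<Rightarrow> real \<Rightarrow> surface set \<Rightarrow> surface \<Rightarrow> bool" where
  "multiplier_depends_on_friction m R g K s \<longleftrightarrow>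
     (\<exists>mu mu' T q q' v v' w w' l l' t.
        (\<forall>r. mu r > 0 \<and> mu' r > 0) \<and>
        ball_motion m R g mu K T q v w l \<and>
        ball_motion m R g mu' K T q' v' w' l' \<and>
        (\<forall>u\<in>T. \<forall>r\<in>K. contact_velocity R (v u) (w u) r \<noteq> 0 \<and> contact_velocity R (v' u) (w' u) r \<noteq> 0) \<and>
        t \<in> T \<and> q t = q' t \<and> v t = v' t \<and> w t = w' t \<and>
        l t s \<noteq> l' t s)"

text \<open>
  The sliding speeds at the table and at the cushion, for a center moving along the
  \<open>x\<close>-axis with velocity \<open>xd\<close>.
\<close>

definition S_table :: "real \<Rightarrow> real \<Rightarrow> real ^ 3 \<Rightarrow> real" where
  "S_table R xd w = sqrt (R\<^sup>2 * (w $ 1)\<^sup>2 + (xd - R * w $ 2)\<^sup>2)"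

definition S_cushion :: "real \<Rightarrow> real \<Rightarrow> real ^ 3 \<Rightarrow> real" where
  "S_cushion R xd w = sqrt (R\<^sup>2 * (w $ 1)\<^sup>2 + (xd + R * w $ 3)\<^sup>2)"

lemma contact_velocity_coordinates:
  "contact_velocity R (vector [xd, 0, 0]) w Table = vector [xd - R * w $ 2, R * w $ 1, 0]"
  "contact_velocity R (vector [xd, 0, 0]) w Cushion = vector [xd + R * w $ 3, 0, - R * w $ 1]"
  by (simp_all add: contact_velocity_def contact_arm_def vec_eq_iff forall_3 cross3_def axis_def algebra_simps)

lemma norm_contact_velocity:
  "norm (contact_velocity R (vector [xd, 0, 0]) w Table) = S_table R xd w"
  "norm (contact_velocity R (vector [xd, 0, 0]) w Cushion) = S_cushion R xd w"
  unfolding contact_velocity_coordinates S_table_def S_cushion_def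
  by (simp_all add: norm_vec_def L2_set_def sum_3 power_mult_distrib add_ac)

lemma eqs_of_motion_coordinates:
  fixes w b :: "real ^ 3" and xd xdd :: real
  assumes "R > 0"
  defines "St \<equiv> S_table R xd w" and "Sc \<equiv> S_cushion R xd w"
  shows "eqs_of_motion m R g mu {Table, Cushion}
           (vector [xd, 0, 0]) w (vector [xdd, 0, 0]) b l \<longleftrightarrow>
         m * xdd = - l Table * mu Table * (xd - R * w $ 2) / St
                   - l Cushion * mu Cushion * (xd + R * w $ 3) / Sc \<and>
         0 = l Cushion - l Table * mu Table * R * w $ 1 / St \<and>
         0 = - m * g + l Table + l Cushion * mu Cushion * R * w $ 1 / Sc \<and>
         2/5 * m * R * b $ 1 = - R * w $ 1 * (l Table * mu Table / St + l Cushion * mu Cushion / Sc) \<and>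
         2/5 * m * R * b $ 2 = l Table * mu Table * (xd - R * w $ 2) / St \<and>
         2/5 * m * R * b $ 3 = - l Cushion * mu Cushion * (xd + R * w $ 3) / Sc"
proof -
  have c: "R * x = R * y \<longleftrightarrow> x = y" for x y using assms by simp
  have sq: "2/5 * m * R\<^sup>2 * y = R * (2/5 * m * R * y)" for y by (simp add: power2_eq_square)
  have f: "contact_force R mu (vector [xd, 0, 0]) w l Table =
      vector [- l Table * mu Table * (xd - R * w $ 2) / St, - l Table * mu Table * R * w $ 1 / St, l Table]"
    "contact_force R mu (vector [xd, 0, 0]) w l Cushion =
      vector [- l Cushion * mu Cushion * (xd + R * w $ 3) / Sc, l Cushion, l Cushion * mu Cushion * R * w $ 1 / Sc]"
    unfolding contact_force_def friction_force_def sgn_div_norm norm_contact_velocity St_def Sc_def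
    by (simp_all add: contact_velocity_coordinates vec_eq_iff forall_3 axis_def divide_simps)
  have t: "cross3 (contact_arm R Table) (vector [p, q, r]) = vector [R * q, - R * p, 0]"
    "cross3 (contact_arm R Cushion) (vector [p, q, r]) = vector [- R * r, 0, R * p]" for p q r
    by (simp_all add: contact_arm_def vec_eq_iff forall_3 cross3_def axis_def algebra_simps)
  have e: "(2/5 * m * R\<^sup>2) *\<^sub>R b = vector [R * p, R * q, R * r] \<longleftrightarrow>
      2/5 * m * R * b $ 1 = p \<and> 2/5 * m * R * b $ 2 = q \<and> 2/5 * m * R * b $ 3 = r" for p q r
    by (simp only: vec_eq_iff forall_3 vector_scaleR_component real_scaleR_def vector_3 sq c)
  have s: "(\<Sum>s\<in>{Table, Cushion}. F s) = F Table + F Cushion" for F :: "surface \<Rightarrow> real ^ 3"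
    by simp
  have v: "(vector [p, q, r] :: real ^ 3) + vector [p', q', r'] = vector [p + p', q + q', r + r']"
    for p q r p' q' r' by (simp add: vec_eq_iff forall_3)
  have u: "(vector [R * (- l Table * mu Table * R * w $ 1 / St) + - R * (l Cushion * mu Cushion * R * w $ 1 / Sc),
        - R * (- l Table * mu Table * (xd - R * w $ 2) / St) + 0,
        0 + R * (- l Cushion * mu Cushion * (xd + R * w $ 3) / Sc)] :: real ^ 3) =
      vector [R * (- R * w $ 1 * (l Table * mu Table / St + l Cushion * mu Cushion / Sc)),
        R * (l Table * mu Table * (xd - R * w $ 2) / St),
        R * (- l Cushion * mu Cushion * (xd + R * w $ 3) / Sc)]"
    by (simp add: vec_eq_iff forall_3 algebra_simps)
  show ?thesis
    unfolding eqs_of_motion_def s f t v u e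
    by (auto simp: vec_eq_iff forall_3 axis_def)
qed

end

(*
The two equations of motion along the normals do not involve the accelerations; they are linear in
the multipliers, with determinant (mu_c mu_t R^2 w_x^2 + S_t S_c) / (S_t S_c) > 0.  The remaining
equations can be solved for the accelerations.

For the dependence on friction, start from rest with a spin about the x-axis only: both sliding
speeds equal R w_x, so the multipliers m g / (1 + mu_c mu_t) and mu_t m g / (1 + mu_c mu_t) are
constant and w_x decreases linearly.

At a single contact the friction is tangential, so the multiplier balances the normal component of
gravity only.
*)
theory Submission
  imports Defs
begin

section \<open>Differentiating the contact constraints\<close>

text \<open>A connected set that is not a singleton has no isolated points, and nonempty interior
  excludes singletons. Hence derivatives within \<open>T\<close> are unique, also at the endpoints
  of \<open>T\<close>.\<close>

lemma interval_at_within_neq_bot: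
  fixes T :: "real set"
  assumes "is_interval T" and "interior T \<noteq> {}" and "t \<in> T"
  shows "at t within T \<noteq> bot"
proof -
  have "T \<noteq> {a}" for a using assms(2) by auto
  then have "t islimpt T"
    using assms by (intro connected_imp_perfect) (auto simp: is_interval_connected)
  then show ?thesis by (simp add: trivial_limit_within)
qed

text \<open>The map \<open>\<lambda>u. f u \<bullet> n\<close> has derivative
  \<open>f' \<bullet> n\<close> by linearity and 0 by constancy; uniqueness identifies the two. It
  serves twice, first for the position and then for the velocity.\<close>

lemma inner_vector_derivative_eq_0:
  fixes f :: "real \<Rightarrow> 'a::real_inner"
  assumes "is_interval T" and "interior T \<noteq> {}" and t: "t \<in> T"
    and d: "(f has_vector_derivative f') (at t within T)"
    and c: "\<And>u. u \<in> T \<Longrightarrow> f u \<bullet> n = c"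
  shows "f' \<bullet> n = 0"
proof -
  have "((\<lambda>u. f u \<bullet> n) has_vector_derivative f' \<bullet> n) (at t within T)"
    using bounded_linear.has_vector_derivative[OF bounded_linear_inner_left d] .
  moreover have "((\<lambda>u. f u \<bullet> n) has_vector_derivative 0) (at t within T)"
    by (rule has_vector_derivative_transform[OF t _ has_vector_derivative_const[of c]]) (simp add: c)
  ultimately show ?thesis
    using vector_derivative_unique_within interval_at_within_neq_bot[OF assms(1-3)] by blast
qed

lemma ball_motion_velocity:
  assumes "ball_motion m R g mu K T q v w l" and "t \<in> T" and "s \<in> K"
  shows "v t \<bullet> normal s = 0"
proof -
  from assms(1) have T: "is_interval T" "interior T \<noteq> {}"
    and d: "\<And>t. t \<in> T \<Longrightarrow> (q has_vector_derivative v t) (at t within T)"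
    and c: "\<And>t s. t \<in> T \<Longrightarrow> s \<in> K \<Longrightarrow> q t \<bullet> normal s = R"
    unfolding ball_motion_def by (blast, blast, blast, metis)
  show ?thesis
    by (rule inner_vector_derivative_eq_0[OF T assms(2) d[OF assms(2)]]) (rule c[OF _ assms(3)])
qed

text \<open>A motion constrains only the position of the center, whereas
  \<open>contact_multipliers\<close> constrains its acceleration; differentiating the constraint
  twice bridges the gap.\<close>

lemma ball_motion_contact_multipliers:
  assumes M: "ball_motion m R g mu K T q v w l" and t: "t \<in> T"
  shows "contact_multipliers m R g mu K (v t) (w t) (l t)"
proof -
  from M obtain a b where T: "is_interval T" "interior T \<noteq> {}"
    and d: "\<And>t. t \<in> T \<Longrightarrow> (v has_vector_derivative a t) (at t within T)"
    and e: "\<And>t. t \<in> T \<Longrightarrow> eqs_of_motion m R g mu K (v t) (w t) (a t) (b t) (l t)"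
    unfolding ball_motion_def by blast
  have "a t \<bullet> normal s = 0" if "s \<in> K" for s
    by (rule inner_vector_derivative_eq_0[OF T t d[OF t]]) (rule ball_motion_velocity[OF M _ that])
  with e[OF t] show ?thesis unfolding contact_multipliers_def by blast
qed

section \<open>One contact\<close>

lemma single_contact_multiplier:
  assumes "contact_multipliers m R g mu {s} v w l" and v: "v \<bullet> normal s = 0"
  shows "l s = m * g * (axis 3 1 \<bullet> normal s)"
proof -
  from assms obtain a where a: "a \<bullet> normal s = 0"
    and e: "m *\<^sub>R a = - (m * g) *\<^sub>R axis 3 1 + contact_force R mu v w l s"
    by (auto simp: contact_multipliers_def eqs_of_motion_def)
  \<comment> \<open>The arm is a multiple of the normal, so the rotational part
    \<open>cross3 w (contact_arm R s)\<close> is orthogonal to it; friction, a multiple of this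
    velocity, is then tangential too.\<close>
  have "contact_velocity R v w s \<bullet> normal s = 0"
    using v by (cases s)
      (simp_all add: contact_velocity_def contact_arm_def inner_axis cross3_def, simp_all add: axis_def)
  then have f: "contact_force R mu v w l s \<bullet> normal s = l s * (normal s \<bullet> normal s)"
    by (simp add: contact_force_def friction_force_def sgn_div_norm inner_add_left inner_diff_left)
  have n: "normal s \<bullet> normal s = 1" by (cases s) (simp_all add: inner_axis)
  have "m * (a \<bullet> normal s) = - (m * g) * (axis 3 1 \<bullet> normal s) + l s"
    using arg_cong[OF e, of "\<lambda>x. x \<bullet> normal s"] by (simp add: inner_add_left inner_diff_left f n)
  with a show ?thesis by simp
qed

section \<open>Two contacts: solving for the multipliers\<close>

text \<open>Here \<open>x\<close>, \<open>y\<close> stand for the cushion and table multipliers,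
  \<open>c\<close>, \<open>d\<close> for the table and cushion friction coefficients,
  \<open>p\<close> for \<open>R * w $ 1\<close> and \<open>G\<close> for the weight. Eliminating
  \<open>x\<close> turns the second equation into \<open>G = y * D / (St * Sc)\<close>, which is
  solvable because \<open>D > 0\<close>.\<close>

lemma normal_equations_iff:
  fixes St Sc c d p G x y :: real
  assumes "St > 0" and "Sc > 0" and "c > 0" and "d > 0"
  defines "D \<equiv> d * c * p\<^sup>2 + St * Sc"
  shows "0 = x - y * c * p / St \<and> 0 = - G + y + x * d * p / Sc \<longleftrightarrow>
    x = G * c * p * Sc / D \<and> y = G * St * Sc / D"
proof -
  have D: "D > 0" unfolding D_def using assms by (intro add_nonneg_pos) auto
  have "x = G * c * p * Sc / D \<and> y = G * St * Sc / D"
    if "x = y * c * p / St" and "G = y + x * d * p / Sc"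
  proof -
    have G: "G = y * D / (St * Sc)"
      using assms(1,2) unfolding that(2) that(1) D_def by (simp add: field_simps power2_eq_square)
    show ?thesis using assms(1,2) D unfolding that(1) G by (simp add: field_simps)
  qed
  moreover have "x = y * c * p / St \<and> G = y + x * d * p / Sc"
    if x: "x = G * c * p * Sc / D" and y: "y = G * St * Sc / D"
  proof
    show "x = y * c * p / St" using assms(1) unfolding x y by simp
    have "y + x * d * p / Sc = G * (d * c * p\<^sup>2 + St * Sc) / D"
      using assms(2) unfolding x y by (simp add: add_divide_distrib algebra_simps power2_eq_square)
    then show "G = y + x * d * p / Sc" using D by (simp add: D_def)
  qed
  moreover have "0 = x - y * c * p / St \<and> 0 = - G + y + x * d * p / Sc \<longleftrightarrow>
      x = y * c * p / St \<and> G = y + x * d * p / Sc"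
    by linarith
  ultimately show ?thesis by blast
qed

lemma contact_multipliers_iff:
  fixes w :: "real ^ 3"
  assumes "m > 0" and "R > 0" and "mu Table > 0" and "mu Cushion > 0"
    and "S_table R xd w \<noteq> 0" and "S_cushion R xd w \<noteq> 0"
  defines "St \<equiv> S_table R xd w" and "Sc \<equiv> S_cushion R xd w"
  defines "D \<equiv> mu Cushion * mu Table * R\<^sup>2 * (w $ 1)\<^sup>2 + St * Sc"
  shows "contact_multipliers m R g mu {Table, Cushion} (vector [xd, 0, 0]) w l \<longleftrightarrow>
    l Cushion = m * g * mu Table * R * w $ 1 * Sc / D \<and> l Table = m * g * St * Sc / D"
proof -
  have S: "St > 0" "Sc > 0" using assms by (simp_all add: S_table_def S_cushion_def less_le)
  let ?E = "\<lambda>xdd b. eqs_of_motion m R g mu {Table, Cushion} (vector [xd, 0, 0]) w (vector [xdd, 0, 0]) b l"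
  let ?N = "0 = l Cushion - l Table * mu Table * R * w $ 1 / St \<and>
    0 = - m * g + l Table + l Cushion * mu Cushion * R * w $ 1 / Sc"
  \<comment> \<open>The two normals span the \<open>y\<close>- and \<open>z\<close>-directions, so
    an admissible acceleration has exactly the shape required by
    \<open>eqs_of_motion_coordinates\<close>.\<close>
  have a: "(\<forall>s\<in>{Table, Cushion}. a \<bullet> normal s = 0) \<longleftrightarrow> (\<exists>xdd. a = vector [xdd, 0, 0])"
    for a :: "real ^ 3" by (auto simp: inner_axis vec_eq_iff forall_3)
  have "contact_multipliers m R g mu {Table, Cushion} (vector [xd, 0, 0]) w l \<longleftrightarrow> (\<exists>xdd b. ?E xdd b)"
    unfolding contact_multipliers_def a by blast
  also have "\<dots> \<longleftrightarrow> ?N"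
  proof
    assume "\<exists>xdd b. ?E xdd b"
    then show ?N unfolding eqs_of_motion_coordinates[OF \<open>R > 0\<close>] St_def Sc_def by blast
  next
    assume N: ?N
    \<comment> \<open>The other four equations are each linear in a single acceleration component,
      with coefficient \<open>m\<close> or \<open>I\<close>; \<open>xdd\<close> and \<open>b\<close>
      are their right-hand sides divided by it.\<close>
    define I where "I = 2/5 * m * R"
    have I: "I * (y / I) = y" for y using assms(1,2) by (simp add: I_def)
    define xdd where "xdd = (- l Table * mu Table * (xd - R * w $ 2) / St
      - l Cushion * mu Cushion * (xd + R * w $ 3) / Sc) / m"
    define b :: "real ^ 3" where
      "b = vector [- R * w $ 1 * (l Table * mu Table / St + l Cushion * mu Cushion / Sc) / I,
        l Table * mu Table * (xd - R * w $ 2) / St / I,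
        - l Cushion * mu Cushion * (xd + R * w $ 3) / Sc / I]"
    have "?E xdd b"
      unfolding eqs_of_motion_coordinates[OF \<open>R > 0\<close>] b_def vector_3
        I_def[symmetric] I St_def[symmetric] Sc_def[symmetric]
      using N assms(1) unfolding xdd_def by (intro conjI; elim conjE) (assumption | simp)+
    then show "\<exists>xdd b. ?E xdd b" by blast
  qed
  also have "\<dots> \<longleftrightarrow> l Cushion = m * g * mu Table * R * w $ 1 * Sc / D \<and> l Table = m * g * St * Sc / D"
    using normal_equations_iff[OF S assms(3,4), of "l Cushion" "l Table" "R * w $ 1" "m * g"]
    by (simp add: D_def power_mult_distrib mult.assoc)
  finally show ?thesis .
qed

text \<open>A function on \<open>surface\<close> is determined by its two values; this turns
  explicit formulas for the multipliers into unique existence.\<close>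

lemma ex1_surface_fun:
  assumes "\<And>l. P l \<longleftrightarrow> l Cushion = x \<and> l Table = y"
  shows "\<exists>!l. P l"
proof (rule ex1I)
  show "P (case_surface y x)" by (simp add: assms)
  show "l = case_surface y x" if "P l" for l
    using that by (auto simp: assms fun_eq_iff split: surface.split)
qed

lemma two_contact_motion_multipliers:
  assumes "m > 0" and "R > 0" and "mu Table > 0" and "mu Cushion > 0"
    and M: "ball_motion m R g mu {Table, Cushion} T q v w l" and t: "t \<in> T"
    and "S_table R (v t $ 1) (w t) \<noteq> 0" and "S_cushion R (v t $ 1) (w t) \<noteq> 0"
  defines "St \<equiv> S_table R (v t $ 1) (w t)" and "Sc \<equiv> S_cushion R (v t $ 1) (w t)"
  defines "D \<equiv> mu Cushion * mu Table * R\<^sup>2 * (w t $ 1)\<^sup>2 + St * Sc"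
  shows "l t Cushion = m * g * mu Table * R * w t $ 1 * Sc / D \<and> l t Table = m * g * St * Sc / D"
proof -
  \<comment> \<open>Orthogonality to both normals leaves only the \<open>x\<close>-component, as
    \<open>contact_multipliers_iff\<close> requires.\<close>
  have "v t = vector [v t $ 1, 0, 0]"
    using ball_motion_velocity[OF M t, of Table] ball_motion_velocity[OF M t, of Cushion]
    by (simp add: inner_axis vec_eq_iff forall_3)
  with ball_motion_contact_multipliers[OF M t]
  have "contact_multipliers m R g mu {Table, Cushion} (vector [v t $ 1, 0, 0]) (w t) (l t)"
    by simp
  then show ?thesis using contact_multipliers_iff[of m R mu] assms by simp
qed

section \<open>A family of spinning motions\<close>

text \<open>With \<open>c\<close> at the table and \<open>d\<close> at the cushion, the last factor
  is the total friction \<open>c * l Table + d * l Cushion\<close> for the multipliers below; the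
  first factor solves the torque equation about the \<open>x\<close>-axis.\<close>

definition spin_deceleration :: "real \<Rightarrow> real \<Rightarrow> real \<Rightarrow> real \<Rightarrow> real \<Rightarrow> real" where
  "spin_deceleration m R g c d = 5 / (2 * m * R) * (m * g * c * (1 + d) / (1 + c * d))"

text \<open>The closed formulas for the multipliers when both sliding speeds equal
  \<open>R * w $ 1\<close>: the spin cancels, so the values do not vary in time.\<close>

definition spin_multiplier :: "real \<Rightarrow> real \<Rightarrow> real \<Rightarrow> real \<Rightarrow> surface \<Rightarrow> real" where
  "spin_multiplier m g c d = case_surface (m * g / (1 + c * d)) (c * (m * g / (1 + c * d)))"

text \<open>Neither contact point slides along the \<open>x\<close>-axis, so friction does not push
  the center along it and only brakes the spin about it. Positivity of the spin keeps the directions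
  of sliding fixed on the whole interval.\<close>

lemma spinning_ball_motion:
  assumes "m > 0" and "R > 0" and c: "mu Table = c" "c > 0" and d: "mu Cushion = d" "d > 0"
    and W: "\<And>t. t \<in> {0..1} \<Longrightarrow> W - spin_deceleration m R g c d * t > 0"
  shows "ball_motion m R g mu {Table, Cushion} {0..1} (\<lambda>_. vector [0, R, R]) (\<lambda>_. vector [0, 0, 0])
    (\<lambda>t. (W - spin_deceleration m R g c d * t) *\<^sub>R axis 1 1) (\<lambda>_. spin_multiplier m g c d)"
proof -
  define k where "k = spin_deceleration m R g c d"
  have pos: "1 + c * d > 0" using c d by (simp add: add_pos_pos)
  have k: "2/5 * m * R * k = m * g * c * (1 + d) / (1 + c * d)"
    using assms(1,2) by (simp add: k_def spin_deceleration_def)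
  \<comment> \<open>The equations of motion keep the form \<open>vector [0, 0, 0]\<close> to match
    \<open>eqs_of_motion_coordinates\<close> with \<open>xd = 0\<close>; the derivatives of
    constants need 0 itself.\<close>
  have z: "(vector [0, 0, 0] :: real ^ 3) = 0" by (simp add: vec_eq_iff forall_3)
  have E: "eqs_of_motion m R g mu {Table, Cushion} (vector [0, 0, 0]) ((W - k * t) *\<^sub>R axis 1 1)
      (vector [0, 0, 0]) (- k *\<^sub>R axis 1 1) (spin_multiplier m g c d)" if t: "t \<in> {0..1}" for t
  proof -
    define p where "p = W - k * t"
    have p: "p > 0" using W[OF t] by (simp add: p_def k_def)
    \<comment> \<open>Since \<open>p > 0\<close>, the square roots give \<open>R * p\<close> without
      an absolute value.\<close>
    have S: "S_table R 0 (p *\<^sub>R axis 1 1) = R * p" "S_cushion R 0 (p *\<^sub>R axis 1 1) = R * p"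
      using p assms(2)
      by (simp_all add: S_table_def S_cushion_def axis_def flip: power_mult_distrib)
    \<comment> \<open>First the torque balance about the \<open>x\<close>-axis, where
      \<open>R * p\<close> cancels and the deceleration is therefore constant; then the vertical
      force balance.\<close>
    have "m * g * c * (1 + d) / (1 + c * d) = R * p * (m * g / (1 + c * d) * c / (R * p) + c * (m * g / (1 + c * d)) * d / (R * p))"
      using p assms(2) pos by (simp add: divide_simps) (simp add: algebra_simps)
    moreover have "m * g = m * g / (1 + c * d) + c * (m * g / (1 + c * d)) * d"
      using pos by (simp add: divide_simps) (simp add: algebra_simps)
    ultimately show ?thesis
      unfolding p_def[symmetric] eqs_of_motion_coordinates[OF assms(2)] S
      using p assms(2) k by (simp add: axis_def spin_multiplier_def c d)
  qed
  have w: "((\<lambda>t. (W - k * t) *\<^sub>R axis 1 1 :: real ^ 3) has_vector_derivative - k *\<^sub>R axis 1 1) (at t within {0..1})" for t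
    by (auto intro!: derivative_eq_intros)
  have n: "if s \<in> {Table, Cushion} then vector [0, R, R] \<bullet> normal s = R else vector [0, R, R] \<bullet> normal s > R" for s
    by (cases s) (simp_all add: inner_axis)
  have "\<exists>a b. \<forall>t\<in>{0..1}.
      ((\<lambda>_. vector [0, R, R] :: real ^ 3) has_vector_derivative vector [0, 0, 0]) (at t within {0..1}) \<and>
      ((\<lambda>_. vector [0, 0, 0] :: real ^ 3) has_vector_derivative a t) (at t within {0..1}) \<and>
      ((\<lambda>t. (W - k * t) *\<^sub>R axis 1 1) has_vector_derivative b t) (at t within {0..1}) \<and>
      eqs_of_motion m R g mu {Table, Cushion} (vector [0, 0, 0]) ((W - k * t) *\<^sub>R axis 1 1) (a t) (b t)
        (spin_multiplier m g c d)"
    by (rule exI[of _ "\<lambda>_. vector [0, 0, 0]"], rule exI[of _ "\<lambda>_. - k *\<^sub>R axis 1 1"])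
      (intro ballI conjI w E, simp_all add: z)
  moreover have "is_interval {0..1 :: real} \<and> interior {0..1 :: real} \<noteq> {}"
    by (simp add: is_interval_cc)
  ultimately show ?thesis
    unfolding ball_motion_def k_def[symmetric] using n by blast
qed

lemma spinning_contact_velocity_neq_0:
  assumes "R > 0" and "p > 0"
  shows "contact_velocity R (vector [0, 0, 0]) (p *\<^sub>R axis 1 1) s \<noteq> 0"
  using assms by (cases s) (simp_all add: contact_velocity_coordinates vec_eq_iff forall_3 axis_def)

section \<open>Dependence on the friction coefficients\<close>

text \<open>In this form unification reads the many witnesses off the facts about two given
  motions.\<close>

lemma multiplier_depends_on_frictionI:
  assumes "\<forall>r. mu r > 0 \<and> mu' r > 0"
    and "ball_motion m R g mu K T q v w l" and "ball_motion m R g mu' K T q' v' w' l'"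
    and "\<forall>u\<in>T. \<forall>r\<in>K. contact_velocity R (v u) (w u) r \<noteq> 0 \<and> contact_velocity R (v' u) (w' u) r \<noteq> 0"
    and "t \<in> T" and "q t = q' t" and "v t = v' t" and "w t = w' t" and "l t s \<noteq> l' t s"
  shows "multiplier_depends_on_friction m R g K s"
  unfolding multiplier_depends_on_friction_def
  by (rule exI[of _ mu], rule exI[of _ mu'], rule exI[of _ T], rule exI[of _ q], rule exI[of _ q'],
      rule exI[of _ v], rule exI[of _ v'], rule exI[of _ w], rule exI[of _ w'], rule exI[of _ l],
      rule exI[of _ l'], rule exI[of _ t], intro conjI assms)

lemma two_contacts_multiplier_depends_on_friction:
  assumes "m > 0" and "R > 0" and "g > 0"
  shows "multiplier_depends_on_friction m R g {Table, Cushion} s"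
proof -
  define k k' where "k = spin_deceleration m R g 1 1" and "k' = spin_deceleration m R g 1 2"
  have pos: "k > 0" "k' > 0" using assms by (simp_all add: k_def k'_def spin_deceleration_def)
  \<comment> \<open>A common initial spin that exceeds both decelerations, so that both spins stay
    positive up to time 1.\<close>
  define W where "W = k + k' + 1"
  have W: "W - k * t > 0" "W - k' * t > 0" if "t \<in> {0..1}" for t
    using that pos mult_left_le[of t k] mult_left_le[of t k'] unfolding W_def atLeastAtMost_iff by linarith+
  \<comment> \<open>Only the cushion coefficient changes, from 1 to 2. With table coefficient 1 the
    two multipliers of each motion are equal: \<open>m * g / 2\<close> in the first and
    \<open>m * g / 3\<close> in the second, so one pair of motions separates both surfaces.\<close>
  let ?mu = "case_surface (1 :: real) 1" and ?mu' = "case_surface (1 :: real) 2"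
  let ?w = "\<lambda>k t. (W - k * t) *\<^sub>R axis 1 1 :: real ^ 3"
  have M: "ball_motion m R g ?mu {Table, Cushion} {0..1} (\<lambda>_. vector [0, R, R]) (\<lambda>_. vector [0, 0, 0])
      (?w k) (\<lambda>_. spin_multiplier m g 1 1)"
    and M': "ball_motion m R g ?mu' {Table, Cushion} {0..1} (\<lambda>_. vector [0, R, R]) (\<lambda>_. vector [0, 0, 0])
      (?w k') (\<lambda>_. spin_multiplier m g 1 2)"
    using W unfolding k_def k'_def by (intro spinning_ball_motion assms; simp)+
  have mu: "\<forall>r. ?mu r > 0 \<and> ?mu' r > 0" by (simp split: surface.split)
  have slide: "\<forall>u\<in>{0..1}. \<forall>r\<in>{Table, Cushion}. contact_velocity R (vector [0, 0, 0]) (?w k u) r \<noteq> 0 \<and>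
      contact_velocity R (vector [0, 0, 0]) (?w k' u) r \<noteq> 0"
    using W by (intro ballI conjI spinning_contact_velocity_neq_0 assms)
  have "spin_multiplier m g 1 1 s \<noteq> spin_multiplier m g 1 2 s"
    using assms by (cases s) (simp_all add: spin_multiplier_def)
  \<comment> \<open>At time 0 both spins equal \<open>W\<close>, so the states agree there.\<close>
  then show ?thesis
    using W[of 0] by (intro multiplier_depends_on_frictionI[OF mu M M' slide, of 0]) auto
qed

text \<open>The value \<open>m * g * (axis 3 1 \<bullet> normal s)\<close> contains neither the
  friction coefficients nor the state, so any two motions have the same multiplier.\<close>

lemma single_contact_multiplier_independent_of_friction:
  "\<not> multiplier_depends_on_friction m R g {s} s"
proof -
  have "l t s = l' t s"
    if "ball_motion m R g mu {s} T q v w l" and "ball_motion m R g mu' {s} T q' v' w' l'" and "t \<in> T"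
    for mu mu' T q q' v v' w w' l l' t
    using single_contact_multiplier[OF ball_motion_contact_multipliers[OF that(1,3)] ball_motion_velocity[OF that(1,3)]]
      single_contact_multiplier[OF ball_motion_contact_multipliers[OF that(2,3)] ball_motion_velocity[OF that(2,3)]]
    by simp
  then show ?thesis unfolding multiplier_depends_on_friction_def by blast
qed

theorem mainTheorem5:
  fixes m R g :: real
  assumes "m > 0" and "R > 0" and "g > 0"
  shows
    "(\<forall>(mu :: surface \<Rightarrow> real) (xd :: real) (w :: real ^ 3).
        let St = S_table R xd w; Sc = S_cushion R xd w;
            D = mu Cushion * mu Table * R\<^sup>2 * (w $ 1)\<^sup>2 + St * Sc
        in mu Table > 0 \<longrightarrow> mu Cushion > 0 \<longrightarrow> St \<noteq> 0 \<longrightarrow> Sc \<noteq> 0 \<longrightarrow>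
           (\<exists>!l. contact_multipliers m R g mu {Table, Cushion} (vector [xd, 0, 0]) w l) \<and>
           (\<forall>l. contact_multipliers m R g mu {Table, Cushion} (vector [xd, 0, 0]) w l \<longrightarrow>
              l Cushion = m * g * mu Table * R * w $ 1 * Sc / D \<and>
              l Table = m * g * St * Sc / D)) \<and>
     (\<forall>(mu :: surface \<Rightarrow> real) T q v w l.
        mu Table > 0 \<longrightarrow> mu Cushion > 0 \<longrightarrow>
        ball_motion m R g mu {Table, Cushion} T q v w l \<longrightarrow>
        (\<forall>t\<in>T. S_table R (v t $ 1) (w t) \<noteq> 0 \<and> S_cushion R (v t $ 1) (w t) \<noteq> 0) \<longrightarrow>
        (\<forall>t\<in>T.
           let St = S_table R (v t $ 1) (w t); Sc = S_cushion R (v t $ 1) (w t);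
               D = mu Cushion * mu Table * R\<^sup>2 * (w t $ 1)\<^sup>2 + St * Sc
           in l t Cushion = m * g * mu Table * R * w t $ 1 * Sc / D \<and>
              l t Table = m * g * St * Sc / D)) \<and>
     (\<forall>s. multiplier_depends_on_friction m R g {Table, Cushion} s) \<and>
     (\<forall>s. \<not> multiplier_depends_on_friction m R g {s} s)"
proof (intro conjI allI)
  fix mu :: "surface \<Rightarrow> real" and xd :: real and w :: "real ^ 3"
  show "let St = S_table R xd w; Sc = S_cushion R xd w;
            D = mu Cushion * mu Table * R\<^sup>2 * (w $ 1)\<^sup>2 + St * Sc
        in mu Table > 0 \<longrightarrow> mu Cushion > 0 \<longrightarrow> St \<noteq> 0 \<longrightarrow> Sc \<noteq> 0 \<longrightarrow>
           (\<exists>!l. contact_multipliers m R g mu {Table, Cushion} (vector [xd, 0, 0]) w l) \<and>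
           (\<forall>l. contact_multipliers m R g mu {Table, Cushion} (vector [xd, 0, 0]) w l \<longrightarrow>
              l Cushion = m * g * mu Table * R * w $ 1 * Sc / D \<and>
              l Table = m * g * St * Sc / D)"
    unfolding Let_def
  proof (intro impI)
    assume "mu Table > 0" "mu Cushion > 0" "S_table R xd w \<noteq> 0" "S_cushion R xd w \<noteq> 0"
    \<comment> \<open>One equivalence serves both claims: from right to left it gives existence,
      from left to right uniqueness and the values.\<close>
    note iff = contact_multipliers_iff[OF assms(1,2) this]
    show "(\<exists>!l. contact_multipliers m R g mu {Table, Cushion} (vector [xd, 0, 0]) w l) \<and>
      (\<forall>l. contact_multipliers m R g mu {Table, Cushion} (vector [xd, 0, 0]) w l \<longrightarrow>
        l Cushion = m * g * mu Table * R * w $ 1 * S_cushion R xd w /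
          (mu Cushion * mu Table * R\<^sup>2 * (w $ 1)\<^sup>2 + S_table R xd w * S_cushion R xd w) \<and>
        l Table = m * g * S_table R xd w * S_cushion R xd w /
          (mu Cushion * mu Table * R\<^sup>2 * (w $ 1)\<^sup>2 + S_table R xd w * S_cushion R xd w))"
      using ex1_surface_fun[OF iff] iff by blast
  qed
next
  show "mu Table > 0 \<longrightarrow> mu Cushion > 0 \<longrightarrow>
        ball_motion m R g mu {Table, Cushion} T q v w l \<longrightarrow>
        (\<forall>t\<in>T. S_table R (v t $ 1) (w t) \<noteq> 0 \<and> S_cushion R (v t $ 1) (w t) \<noteq> 0) \<longrightarrow>
        (\<forall>t\<in>T.
           let St = S_table R (v t $ 1) (w t); Sc = S_cushion R (v t $ 1) (w t);
               D = mu Cushion * mu Table * R\<^sup>2 * (w t $ 1)\<^sup>2 + St * Sc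
           in l t Cushion = m * g * mu Table * R * w t $ 1 * Sc / D \<and>
              l t Table = m * g * St * Sc / D)" for mu T q v w l
    unfolding Let_def using two_contact_motion_multipliers[OF assms(1,2)] by blast
next
  show "multiplier_depends_on_friction m R g {Table, Cushion} s" for s
    using assms by (rule two_contacts_multiplier_depends_on_friction)
next
  show "\<not> multiplier_depends_on_friction m R g {s} s" for s
    by (rule single_contact_multiplier_independent_of_friction)
qed

end
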